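(* Let $n,k,r$ be positive integers with $r\geq 2$ and $n\geq rk$. The circular clique number of $\mathrm{IG}_{n,k}^{(r)}$ is $n/k$.
   Context: Write $[n]=\{1,\ldots,n\}$ and view its elements as placed in clockwise order on a circle; a $k$-subset of $[n]$ is called a $k$-polygon. A $k$-polygon $P$ is $r$-stable if the cyclic distance (on $\mathbb{Z}/n\mathbb{Z}$) between any two distinct points of $P$ is at least $r$. Two $k$-polygons $P=\{p_1<\cdots<p_k\}$ and $Q=\{q_1<\cdots<q_k\}$ interlace if either $p_1<q_1<p_2<q_2<\cdots<p_k<q_k$ or $q_1<p_1<q_2<p_2<\cdots<q_k<p_k$. The graph $\mathrm{IG}_{n,k}^{(r)}$ has as vertices the $r$-stable $k$-polygons on $[n]$, two being adjacent iff they interlace. For positive integers $a\geq 2b$, the circular clique $K_{a/b}$ is the graph with vertex set $\mathbb{Z}/a\mathbb{Z}$ in which two vertices are adjacent iff their cyclic distance is at least $b$. The circular clique number $\omega_c(G)$ of a graph $G$ is the maximum rational $a/b$ such that there is a graph homomorphism $K_{a/b}\to G$. *)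

theory Defs
  imports Complex_Main "Graph_Theory.Pair_Digraph"
begin

text \<open>
  Finite simple graphs are represented by \<^typ>\<open>'a pair_pre_digraph\<close>: an undirected edge is a pair
  of opposite arcs. Residue classes modulo \<open>n\<close> are given by arbitrary representatives.
\<close>

definition cyclic_dist :: "nat \<Rightarrow> nat \<Rightarrow> nat \<Rightarrow> nat" where
  "cyclic_dist n i j = nat (min ((int i - int j) mod int n) ((int j - int i) mod int n))"

definition polygon :: "nat \<Rightarrow> nat \<Rightarrow> nat set \<Rightarrow> bool" where
  "polygon n k P \<longleftrightarrow> P \<subseteq> {1..n} \<and> card P = k"

definition stable :: "nat \<Rightarrow> nat \<Rightarrow> nat set \<Rightarrow> bool" where
  "stable n r P \<longleftrightarrow> (\<forall>x\<in>P. \<forall>y\<in>P. x \<noteq> y \<longrightarrow> r \<le> cyclic_dist n x y)"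

text \<open>
  For lists of equal length, \<^term>\<open>splice ps qs\<close> is \<open>[p\<^sub>1, q\<^sub>1, p\<^sub>2, q\<^sub>2, \<dots>, p\<^sub>k, q\<^sub>k]\<close>. The
  notion is meant for finite sets \<open>P\<close> and \<open>Q\<close> of equal cardinality.
\<close>

definition interlace :: "nat set \<Rightarrow> nat set \<Rightarrow> bool" where
  "interlace P Q \<longleftrightarrow>
     sorted_wrt (<) (splice (sorted_list_of_set P) (sorted_list_of_set Q)) \<or>
     sorted_wrt (<) (splice (sorted_list_of_set Q) (sorted_list_of_set P))"

definition interlacing_graph :: "nat \<Rightarrow> nat \<Rightarrow> nat \<Rightarrow> nat set pair_pre_digraph" where
  "interlacing_graph n k r =
     \<lparr> pverts = {P. polygon n k P \<and> stable n r P},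
       parcs = {(P, Q). polygon n k P \<and> stable n r P \<and> polygon n k Q \<and> stable n r Q
                  \<and> interlace P Q} \<rparr>"

definition circular_clique :: "nat \<Rightarrow> nat \<Rightarrow> nat pair_pre_digraph" where
  "circular_clique a b =
     \<lparr> pverts = {0..<a},
       parcs = {(i, j). i \<in> {0..<a} \<and> j \<in> {0..<a} \<and> b \<le> cyclic_dist a i j} \<rparr>"

definition graph_hom :: "'a pair_pre_digraph \<Rightarrow> 'b pair_pre_digraph \<Rightarrow> ('a \<Rightarrow> 'b) \<Rightarrow> bool" where
  "graph_hom G H f \<longleftrightarrow>
     f ` pverts G \<subseteq> pverts H \<and> (\<forall>(u, v) \<in> parcs G. (f u, f v) \<in> parcs H)"

definition circular_clique_ratios :: "'a pair_pre_digraph \<Rightarrow> rat set" where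
  "circular_clique_ratios G =
     {of_nat a / of_nat b | a b. 0 < b \<and> 2 * b \<le> a \<and> (\<exists>f. graph_hom (circular_clique a b) G f)}"

text \<open>
  The circular clique number is a maximum that need not exist for an arbitrary graph (e.g. one
  without edges), so it is a relation: its value is \<open>q\<close> iff the maximum exists and equals \<open>q\<close>.
\<close>

definition has_circular_clique_number :: "'a pair_pre_digraph \<Rightarrow> rat \<Rightarrow> bool" where
  "has_circular_clique_number G q \<longleftrightarrow>
     q \<in> circular_clique_ratios G \<and> (\<forall>s \<in> circular_clique_ratios G. s \<le> q)"

lemma pair_graph_circular_clique:
  assumes "0 < b"
  shows "pair_graph (circular_clique a b)"
proof -
  have "finite (parcs (circular_clique a b))"
    by (rule finite_subset[of _ "{0..<a} \<times> {0..<a}"]) (auto simp: circular_clique_def)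
  moreover have "symmetric (with_proj (circular_clique a b))"
    unfolding symmetric_def
    by (auto simp: circular_clique_def cyclic_dist_def min.commute intro!: symI)
  ultimately show ?thesis
    using assms by unfold_locales (auto simp: circular_clique_def cyclic_dist_def)
qed

lemma not_interlace_self:
  assumes "finite P" "P \<noteq> {}"
  shows "\<not> interlace P P"
proof -
  obtain x xs where "sorted_list_of_set P = x # xs"
    using assms by (cases "sorted_list_of_set P") auto
  then show ?thesis
    by (simp add: interlace_def)
qed

lemma pair_graph_interlacing_graph:
  assumes "0 < k"
  shows "pair_graph (interlacing_graph n k r)"
proof -
  have fin: "finite (pverts (interlacing_graph n k r))"
    by (rule finite_subset[of _ "Pow {1..n}"]) (auto simp: interlacing_graph_def polygon_def)
  have arcs: "parcs (interlacing_graph n k r)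
      \<subseteq> pverts (interlacing_graph n k r) \<times> pverts (interlacing_graph n k r)"
    by (auto simp: interlacing_graph_def)
  then have "finite (parcs (interlacing_graph n k r))"
    using fin by (meson finite_SigmaI finite_subset)
  moreover have "symmetric (with_proj (interlacing_graph n k r))"
    unfolding symmetric_def
    by (auto simp: interlacing_graph_def interlace_def intro!: symI)
  moreover have "fst e \<noteq> snd e" if e: "e \<in> parcs (interlacing_graph n k r)" for e
  proof
    assume "fst e = snd e"
    with e have "polygon n k (fst e)" "interlace (fst e) (fst e)"
      by (auto simp: interlacing_graph_def)
    moreover from this(1) have "finite (fst e)" "fst e \<noteq> {}"
      using assms by (auto simp: polygon_def intro: finite_subset)
    ultimately show False
      using not_interlace_self by blast
  qed
  ultimately show ?thesis
    using fin arcs by unfold_locales auto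
qed

end

theory Submission
  imports Defs
begin

text \<open>
  Upper bound: interlacing polygons are disjoint, so for a homomorphism \<open>f\<close> from \<open>K\<^bsub>a/b\<^esub>\<close> and
  each point \<open>x\<close> the vertices \<open>i\<close> with \<open>x \<in> f i\<close> form an independent set of \<open>K\<^bsub>a/b\<^esub>\<close>, which has
  at most \<open>b\<close> elements. Counting the pairs \<open>(i, x)\<close> with \<open>x \<in> f i\<close> in two ways gives \<open>a k \<le> n b\<close>.
  Lower bound: mapping \<open>i < n\<close> to the balanced polygon \<open>{\<lfloor>(i + j n) / k\<rfloor> + 1 | j < k}\<close> is a
  homomorphism from \<open>K\<^bsub>n/k\<^esub>\<close>, in general not injective.
\<close>

section \<open>Cyclic distance and independent sets of circular cliques\<close>

lemma cyclic_dist_commute: "cyclic_dist n i j = cyclic_dist n j i"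
  by (simp add: cyclic_dist_def min.commute)

lemma cyclic_dist_eq_min:
  assumes "i \<le> j" "j - i < n"
  shows "cyclic_dist n i j = min (j - i) (n - (j - i))"
\<comment> \<open>The case \<open>i = j\<close> is separate: there both residues are 0, whereas
  \<open>n - (j - i)\<close> is \<open>n\<close>.\<close>
proof (cases "i = j")
  case False
  define d where "d = j - i"
  have d: "0 < d" "d < n" "j = i + d"
    using assms False by (auto simp: d_def)
  have "(int i - int j) mod int n = (int n - int d) mod int n"
    using mod_add_self2[of "- int d" "int n"] d(3) by (simp add: algebra_simps)
  also have "\<dots> = int n - int d"
    using d by (intro mod_pos_pos_trivial) auto
  finally have "(int i - int j) mod int n = int n - int d" .
  moreover have "(int j - int i) mod int n = int d"
    using d by simp
  ultimately show ?thesis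
    using d by (simp add: cyclic_dist_def)
qed (simp add: cyclic_dist_def)

text \<open>Non-adjacency to the least element \<open>s\<close> puts every offset
  \<open>x - s\<close> below \<open>b\<close> or above \<open>a - b\<close>. Subtracting
  \<open>a - b\<close> from the large offsets folds them into the range below \<open>b\<close>, and
  no two elements of \<open>S\<close> collide.\<close>

lemma card_independent_circular_clique:
  assumes "0 < b" "2 * b \<le> a" and S: "S \<subseteq> {0..<a}"
    and indep: "\<And>i j. i \<in> S \<Longrightarrow> j \<in> S \<Longrightarrow> cyclic_dist a i j < b"
  shows "card S \<le> b"
proof (cases "S = {}")
  case False
  have fin: "finite S"
    using S finite_subset by blast
  define s where "s = Min S"
  have s: "s \<in> S" "\<And>x. x \<in> S \<Longrightarrow> s \<le> x"
    using fin False by (auto simp: s_def)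
  have lt: "x < a" if "x \<in> S" for x
    using S that by auto
  have dist: "min (y - x) (a - (y - x)) < b" if "x \<in> S" "y \<in> S" "x \<le> y" for x y
    using indep[OF that(1,2)] cyclic_dist_eq_min[of x y a] that(3) lt[OF that(2)] by simp
  \<comment> \<open>Points at clockwise distance \<open>d\<close> and \<open>d + (a - b)\<close> from \<open>s\<close> are adjacent, so \<open>S\<close> contains
    at most one of them.\<close>
  define g where "g x = (if x - s < b then x - s else x - s + b - a)" for x
  have far: "a - b < x - s" if "x \<in> S" "\<not> x - s < b" for x
    using dist[OF s(1) that(1) s(2)[OF that(1)]] that(2) lt[OF that(1)]
    by (auto simp: min_def split: if_splits)
  have clash: False if "x \<in> S" "y \<in> S" "x - s < b" "\<not> y - s < b" "x - s = y - s + b - a" for x y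
  proof -
    have "y - x = a - b" "x \<le> y"
      using that far[OF that(2,4)] s(2)[OF that(1)] s(2)[OF that(2)] assms(1,2) by linarith+
    \<comment> \<open>By \<open>2 * b \<le> a\<close>, the smaller of the arcs \<open>a - b\<close>
      and \<open>b\<close> is \<open>b\<close>, too far apart for two elements of
      \<open>S\<close>.\<close>
    then show False
      using dist[OF that(1,2)] assms(1,2) by simp
  qed
  have "inj_on g S"
  proof (rule inj_onI)
    fix x y assume xy: "x \<in> S" "y \<in> S" "g x = g y"
    then show "x = y"
      using clash[of x y] clash[of y x] far[of x] far[of y] s(2)[of x] s(2)[of y] assms(1,2)
      by (auto simp: g_def split: if_splits)
  qed
  moreover have "g ` S \<subseteq> {0..<b}"
    using lt assms(1) by (fastforce simp: g_def)
  ultimately show ?thesis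
    using card_inj_on_le[of g S "{0..<b}"] by simp
qed simp

section \<open>Upper bound by double counting\<close>

text \<open>A strictly increasing splice has no repetitions, so the size of the union equals the
  length of the splice, which is the sum of the two cardinalities.\<close>

lemma interlace_disjoint:
  assumes "finite P" "finite Q" "interlace P Q"
  shows "P \<inter> Q = {}"
proof -
  have "card (A \<union> B) = card A + card B"
    if "finite A" "finite B"
      "sorted_wrt (<) (splice (sorted_list_of_set A) (sorted_list_of_set B))" for A B :: "nat set"
  proof -
    have "distinct (splice (sorted_list_of_set A) (sorted_list_of_set B))"
      using that(3) strict_sorted_iff by blast
    from distinct_card[OF this] show ?thesis
      using that(1,2) by (simp add: set_shuffles[OF splice_in_shuffles])
  qed
  then have "card (P \<union> Q) = card P + card Q"
    using assms unfolding interlace_def by (metis Un_commute add.commute)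
  then show ?thesis
    using card_Un_Int[OF assms(1,2)] assms(1) by simp
qed

lemma circular_clique_ratio_le:
  assumes "0 < b" "2 * b \<le> a"
    and hom: "graph_hom (circular_clique a b) (interlacing_graph n k r) f"
  shows "a * k \<le> n * b"
proof -
  have poly: "f i \<subseteq> {1..n}" "card (f i) = k" if "i < a" for i
  proof -
    have "f i \<in> pverts (interlacing_graph n k r)"
      using hom that unfolding graph_hom_def by (auto simp: circular_clique_def)
    then show "f i \<subseteq> {1..n}" "card (f i) = k"
      by (auto simp: interlacing_graph_def polygon_def)
  qed
  have fin: "finite (f i)" if "i < a" for i
    using poly(1)[OF that] finite_subset by blast
  have disj: "f i \<inter> f j = {}" if "i < a" "j < a" "b \<le> cyclic_dist a i j" for i j
  proof -
    have "(i, j) \<in> parcs (circular_clique a b)"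
      using that by (simp add: circular_clique_def)
    then have "interlace (f i) (f j)"
      using hom by (auto simp: graph_hom_def interlacing_graph_def)
    then show ?thesis
      using interlace_disjoint fin that by blast
  qed
  have "a * k = (\<Sum>i\<in>{0..<a}. card {x\<in>{1..n}. x \<in> f i})"
  proof -
    have "{x\<in>{1..n}. x \<in> f i} = f i" if "i < a" for i
      using poly(1)[OF that] by auto
    then show ?thesis
      using poly(2) by simp
  qed
  also have "\<dots> = (\<Sum>x\<in>{1..n}. card {i\<in>{0..<a}. x \<in> f i})"
    by (rule sum_multicount_gen) auto
  also have "\<dots> \<le> (\<Sum>x\<in>{1..n}. b)"
  proof (rule sum_mono, rule card_independent_circular_clique[OF assms(1,2)])
    fix x i j
    assume "i \<in> {i\<in>{0..<a}. x \<in> f i}" "j \<in> {i\<in>{0..<a}. x \<in> f i}"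
    then show "cyclic_dist a i j < b"
      using disj[of i j] by (auto simp flip: not_le)
  qed auto
  finally show ?thesis
    by simp
qed

section \<open>Interlacing from increasing enumerations\<close>

lemma splice_snoc_snoc:
  "length xs = length ys \<Longrightarrow> splice (xs @ [x]) (ys @ [y]) = splice xs ys @ [x, y]"
  by (induction xs ys rule: list_induct2) auto

text \<open>The second conjunct strengthens the induction: with all earlier entries at most the last
  \<open>q\<close>, the next \<open>p\<close> can be appended.\<close>

lemma sorted_splice_map:
  fixes p q :: "nat \<Rightarrow> nat"
  assumes "\<And>j. j < m \<Longrightarrow> p j < q j" "\<And>j. Suc j < m \<Longrightarrow> q j < p (Suc j)"
  shows "sorted_wrt (<) (splice (map p [0..<m]) (map q [0..<m])) \<and>
    (\<forall>x\<in>set (splice (map p [0..<m]) (map q [0..<m])). x \<le> q (m - 1))"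
  using assms
proof (induction m)
  case (Suc m)
  let ?l = "splice (map p [0..<m]) (map q [0..<m])"
  have IH: "sorted_wrt (<) ?l" "\<forall>x\<in>set ?l. x \<le> q (m - 1)"
    using Suc by auto
  have last: "p m < q m"
    using Suc.prems by simp
  have less: "\<forall>x\<in>set ?l. x < p m"
  proof (cases m)
    case (Suc l)
    then show ?thesis
      using IH(2) Suc.prems(2)[of l] by auto
  qed simp
  have "splice (map p [0..<Suc m]) (map q [0..<Suc m]) = ?l @ [p m, q m]"
    by (simp add: splice_snoc_snoc)
  then show ?case
    using IH(1) less last by (auto simp: sorted_wrt_append)
qed simp

lemma interlace_image:
  fixes p q :: "nat \<Rightarrow> nat"
  assumes p: "strict_mono_on {0..<m} p" and q: "strict_mono_on {0..<m} q"
    and "\<And>j. j < m \<Longrightarrow> p j < q j" "\<And>j. Suc j < m \<Longrightarrow> q j < p (Suc j)"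
  shows "interlace (p ` {0..<m}) (q ` {0..<m})"
proof -
  have "sorted_list_of_set (h ` {0..<m}) = map h [0..<m]"
    if "strict_mono_on {0..<m} h" for h :: "nat \<Rightarrow> nat"
  proof -
    have "sorted_wrt (<) (map h [0..<m])"
      using that by (auto simp: sorted_wrt_iff_nth_less strict_mono_on_def)
    then show ?thesis
      using sorted_list_of_set.idem_if_sorted_distinct[of "map h [0..<m]"]
      by (simp add: strict_sorted_iff)
  qed
  then show ?thesis
    using assms sorted_splice_map[of m p q] by (simp add: interlace_def)
qed

section \<open>Balanced polygons\<close>

lemma div_add_le:
  fixes x y k c :: nat
  assumes "0 < k" "x + c * k \<le> y"
  shows "x div k + c \<le> y div k"
  using div_le_mono[OF assms(2), of k] assms(1) by simp

text \<open>For \<open>i < n\<close> and \<open>j < k\<close> the numerators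
  \<open>i + j * n\<close> run once through the numbers below \<open>n * k\<close>, so each point of
  \<open>{1..n}\<close> is hit exactly \<open>k\<close> times. This is the equality case of the
  double count.\<close>

definition balanced_point :: "nat \<Rightarrow> nat \<Rightarrow> nat \<Rightarrow> nat \<Rightarrow> nat" where
  "balanced_point n k i j = (i + j * n) div k + 1"

definition balanced_polygon :: "nat \<Rightarrow> nat \<Rightarrow> nat \<Rightarrow> nat set" where
  "balanced_polygon n k i = balanced_point n k i ` {0..<k}"

text \<open>Numerators of consecutive points differ by \<open>n\<close>, hence by at least
  \<open>r * k\<close> before the division by \<open>k\<close>.\<close>

lemma balanced_point_gap:
  assumes "0 < k" "r * k \<le> n" "j < j'"
  shows "balanced_point n k i j + r \<le> balanced_point n k i j'"
proof -
  have "j * n + n \<le> j' * n"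
    using assms(3) mult_le_mono1[of "Suc j" j' n] by simp
  then show ?thesis
    using div_add_le[of k "i + j * n" r "i + j' * n"] assms(1,2) by (simp add: balanced_point_def)
qed

text \<open>A full turn of length \<open>n\<close> adds \<open>n * k\<close> to the numerator. As
  \<open>j' < k\<close>, the numerator of \<open>j'\<close> stays at least
  \<open>n \<ge> r * k\<close> short of that of \<open>j\<close> one turn later.\<close>

lemma balanced_point_gap_wrap:
  assumes "0 < k" "r * k \<le> n" "j' < k"
  shows "balanced_point n k i j' + r \<le> balanced_point n k i j + n"
proof -
  have "j' * n + n \<le> n * k"
    using assms(3) mult_le_mono1[of "Suc j'" k n] by (simp add: mult.commute)
  then have "i + j' * n + r * k \<le> i + j * n + n * k"
    using assms(2) by simp
  then have "(i + j' * n) div k + r \<le> (i + j * n + n * k) div k"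
    using div_add_le assms(1) by blast
  then show ?thesis
    using assms(1) by (simp add: balanced_point_def)
qed

lemma strict_mono_on_balanced_point:
  assumes "0 < k" "k \<le> n"
  shows "strict_mono_on A (balanced_point n k i)"
proof (rule strict_mono_onI)
  fix j j' :: nat assume "j < j'"
  then show "balanced_point n k i j < balanced_point n k i j'"
    using balanced_point_gap[of k 1 n j j' i] assms by simp
qed

lemma polygon_balanced_polygon:
  assumes "0 < k" "k \<le> n" "i < n"
  shows "polygon n k (balanced_polygon n k i)"
proof -
  have "inj_on (balanced_point n k i) {0..<k}"
    using assms strict_mono_on_balanced_point strict_mono_on_imp_inj_on by blast
  moreover have "balanced_point n k i j \<in> {1..n}" if "j < k" for j
  proof -
    have "j * n + n \<le> n * k"
      using that mult_le_mono1[of "Suc j" k n] by (simp add: mult.commute)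
    then have "(i + j * n) div k < n"
      using assms by (simp add: div_less_iff_less_mult)
    then show ?thesis
      by (simp add: balanced_point_def)
  qed
  ultimately show ?thesis
    by (auto simp: polygon_def balanced_polygon_def card_image)
qed

lemma stable_balanced_polygon:
  assumes "0 < k" "0 < r" "r * k \<le> n"
  shows "stable n r (balanced_polygon n k i)"
proof -
  \<comment> \<open>The two gap lemmas bound the two arcs between the points. With
    \<open>0 < r\<close> the wrapped one also gives a difference below \<open>n\<close>, as
    \<open>cyclic_dist_eq_min\<close> requires.\<close>
  have le: "r \<le> cyclic_dist n (balanced_point n k i j) (balanced_point n k i j')"
    if "j < j'" "j' < k" for j j'
    using balanced_point_gap[OF assms(1,3) that(1), of i]
      balanced_point_gap_wrap[OF assms(1,3) that(2), of i j] assms(2)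
    by (subst cyclic_dist_eq_min) auto
  show ?thesis
    unfolding stable_def balanced_polygon_def
  proof (intro ballI impI)
    fix x y
    assume "x \<in> balanced_point n k i ` {0..<k}" "y \<in> balanced_point n k i ` {0..<k}" "x \<noteq> y"
    then obtain j j' where "x = balanced_point n k i j" "y = balanced_point n k i j'"
      "j < k" "j' < k" "j \<noteq> j'"
      by force
    then show "r \<le> cyclic_dist n x y"
      using le[of j j'] le[of j' j] cyclic_dist_commute by (metis nat_neq_iff)
  qed
qed

text \<open>The numerators \<open>i + j * n\<close>, \<open>i' + j * n\<close> and
  \<open>i + (j + 1) * n\<close> increase in steps of at least \<open>k\<close>, so their quotients
  by \<open>k\<close> stay strictly ordered.\<close>

lemma interlace_balanced_polygon:
  assumes "0 < k" "k \<le> n" "i + k \<le> i'" "i' + k \<le> i + n"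
  shows "interlace (balanced_polygon n k i) (balanced_polygon n k i')"
  unfolding balanced_polygon_def
proof (rule interlace_image)
  fix j
  show "balanced_point n k i j < balanced_point n k i' j"
    using div_add_le[of k "i + j * n" 1 "i' + j * n"] assms by (simp add: balanced_point_def)
  show "balanced_point n k i' j < balanced_point n k i (Suc j)"
    using div_add_le[of k "i' + j * n" 1 "i + Suc j * n"] assms by (simp add: balanced_point_def)
qed (use assms strict_mono_on_balanced_point in auto)

lemma graph_hom_balanced_polygon:
  assumes "0 < k" "0 < r" "r * k \<le> n"
  shows "graph_hom (circular_clique n k) (interlacing_graph n k r) (balanced_polygon n k)"
proof -
  have "k \<le> n"
    using assms by (metis le_trans mult_le_mono1 nat_mult_1 Suc_leI One_nat_def)
  note vertex = polygon_balanced_polygon[OF assms(1) this] stable_balanced_polygon[OF assms]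
  \<comment> \<open>Cyclic distance at least \<open>k\<close> means that both arcs,
    \<open>i' - i\<close> and \<open>n - (i' - i)\<close>, have length at least \<open>k\<close>.
    The case \<open>i' \<le> i\<close> follows by symmetry.\<close>
  have le: "interlace (balanced_polygon n k i) (balanced_polygon n k i')"
    if "i \<le> i'" "i' < n" "k \<le> cyclic_dist n i i'" for i i'
    using that cyclic_dist_eq_min[of i i' n] assms(1) \<open>k \<le> n\<close>
    by (intro interlace_balanced_polygon) auto
  have "interlace (balanced_polygon n k i) (balanced_polygon n k i')"
    if "i < n" "i' < n" "k \<le> cyclic_dist n i i'" for i i'
    using le[of i i'] le[of i' i] that cyclic_dist_commute[of n i i']
    by (metis interlace_def nat_le_linear)
  then show ?thesis
    using vertex by (auto simp: graph_hom_def circular_clique_def interlacing_graph_def)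
qed

theorem theorem4:
  fixes n k r :: nat
  assumes "0 < n" and "0 < k" and "2 \<le> r" and "r * k \<le> n"
  shows "has_circular_clique_number (interlacing_graph n k r) (of_nat n / of_nat k)"
  unfolding has_circular_clique_number_def
proof
  \<comment> \<open>The hypothesis \<open>2 \<le> r\<close> makes \<open>n / k\<close> an admissible
    ratio.\<close>
  have "2 * k \<le> n"
    using assms(3,4) by (meson le_trans mult_le_mono1)
  moreover have "graph_hom (circular_clique n k) (interlacing_graph n k r) (balanced_polygon n k)"
    using assms by (intro graph_hom_balanced_polygon) auto
  ultimately show "of_nat n / of_nat k \<in> circular_clique_ratios (interlacing_graph n k r)"
    using assms(2) unfolding circular_clique_ratios_def by blast
  show "\<forall>s\<in>circular_clique_ratios (interlacing_graph n k r). s \<le> of_nat n / of_nat k"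
  proof
    fix s
    assume "s \<in> circular_clique_ratios (interlacing_graph n k r)"
    then obtain a b f where s: "s = of_nat a / of_nat b" and b: "0 < b" "2 * b \<le> a"
      and "graph_hom (circular_clique a b) (interlacing_graph n k r) f"
      unfolding circular_clique_ratios_def by blast
    then have "a * k \<le> n * b"
      using circular_clique_ratio_le by blast
    then have "(of_nat a * of_nat k :: rat) \<le> of_nat n * of_nat b"
      by (metis of_nat_le_iff of_nat_mult)
    then show "s \<le> of_nat n / of_nat k"
      using b assms(2) by (simp add: s field_simps)
  qed
qed

end
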